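(* Let $\lambda\in\{2,3\}$, let $k\ge \lambda+2$ and $d\ge\lambda$ be integers, and let $X=\{x_1,\dots,x_n\}$ be a collection of $n=d+2(k-\lambda)$ points in general position in $\mathbb{R}^d$. Suppose that $L$ is a $(d-\lambda)$-plane transversal to the convex hulls of all $k$-sets of $X$. Then either (1) $L$ is a complete Kneser transversal, i.e. $L$ contains $d-\lambda+1$ points of $X$; or (2) $|X\cap L|=d-2(\lambda-1)$ and the other $2(k-1)$ points of $X$ are matched in $k-1$ pairs in such a way that $L$ intersects each of the $k-1$ closed segments determined by these pairs.
   Context: A $j$-plane is a $j$-dimensional affine subspace of $\mathbb{R}^d$. A $k$-set of $X$ is a subset of $X$ with $k$ elements. A plane $L$ is transversal to a family of sets if it intersects every member of the family. A set of points in $\mathbb{R}^d$ is in general position if it is affinely in general position, i.e. every subset of at most $d+1$ of its points is affinely independent. *)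

theory Defs
  imports "HOL-Analysis.Analysis"
begin

definition is_plane :: "nat \<Rightarrow> 'a::euclidean_space set \<Rightarrow> bool" where
  "is_plane j L \<longleftrightarrow> affine L \<and> aff_dim L = int j"

definition k_sets :: "nat \<Rightarrow> 'a set \<Rightarrow> 'a set set" where
  "k_sets k X = {S. S \<subseteq> X \<and> finite S \<and> card S = k}"

definition transversal_to :: "'a set \<Rightarrow> 'a set set \<Rightarrow> bool" where
  "transversal_to L F \<longleftrightarrow> (\<forall>C\<in>F. L \<inter> C \<noteq> {})"

definition general_position :: "'a::euclidean_space set \<Rightarrow> bool" where
  "general_position X \<longleftrightarrow>
     (\<forall>S\<subseteq>X. finite S \<and> card S \<le> DIM('a) + 1 \<longrightarrow> \<not> affine_dependent S)"

(* Here lam is the codimension, as in "(d - lam)-plane", d being the dimension of the ambient space. *)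
definition kneser_transversal :: "nat \<Rightarrow> nat \<Rightarrow> 'a::euclidean_space set \<Rightarrow> 'a set \<Rightarrow> bool" where
  "kneser_transversal lam k X L \<longleftrightarrow>
     is_plane (DIM('a) - lam) L \<and> transversal_to L ((\<lambda>S. convex hull S) ` k_sets k X)"

(* For X in general position a (d - lam)-plane contains at most d - lam + 1 points of X,
   so "contains d - lam + 1 points" is an exact count. *)
definition complete_kneser_transversal ::
    "nat \<Rightarrow> nat \<Rightarrow> 'a::euclidean_space set \<Rightarrow> 'a set \<Rightarrow> bool" where
  "complete_kneser_transversal lam k X L \<longleftrightarrow>
     kneser_transversal lam k X L \<and> card (X \<inter> L) = DIM('a) - lam + 1"

definition pair_matching :: "'a set \<Rightarrow> 'a set set \<Rightarrow> bool" where
  "pair_matching Y M \<longleftrightarrow> partition_on Y M \<and> (\<forall>P\<in>M. card P = 2)"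

end

theory Submission
  imports Defs
begin

text \<open>
  Projecting along \<open>L\<close> turns the points of \<open>X - L\<close> into nonzero vectors \<open>y x\<close>, and transversality says
  that every open half-space through the origin contains at most \<open>k - 1\<close> of them. Take a subspace
  \<open>S\<close> containing \<open>c\<close> of these vectors, a generic hyperplane through \<open>S\<close>, and tilt it towards \<open>w\<close> in
  both of its orientations: the number \<open>c\<^sub>w\<close> of vectors in \<open>S\<close> on the positive side of \<open>w\<close> satisfies
  \<open>|X - L| + 2 c\<^sub>w \<le> 2 (k - 1) + c\<close>.

  For \<open>S = 0\<close> this gives \<open>|X - L| \<le> 2 (k - 1)\<close>. If equality holds, every line carries equally
  many vectors in its two directions; general position leaves at most three on it, so the vectors come
  in antipodal pairs. If \<open>L\<close> is not complete, the only other possibility is \<open>|X - L| = 2 (k - 1) - 1\<close>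
  with codimension 3. Then a plane spanned by two vectors on the same side of a generic hyperplane
  contains exactly one further vector, on the other side. Double counting the pairs on different sides
  leaves room for at most four pairwise non-parallel vectors, which is too few.
\<close>

section \<open>Generic hyperplanes and the counting inequality\<close>

text \<open>A small multiple of \<open>w\<close> cannot change a nonzero sign, and where
  \<open>u\<close> vanishes only the term from \<open>w\<close> is left. Finiteness of
  \<open>F\<close> provides a common \<open>e\<close>.\<close>

lemma tilt:
  fixes u w :: "'a::real_inner"
  assumes "finite F"
  shows "\<exists>e>0. \<forall>y\<in>F. sgn ((u + e *\<^sub>R w) \<bullet> y) = (if u \<bullet> y = 0 then sgn (w \<bullet> y) else sgn (u \<bullet> y))"
proof -
  have "\<forall>\<^sub>F e in at_right (0::real). sgn ((u + e *\<^sub>R w) \<bullet> y)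
      = (if u \<bullet> y = 0 then sgn (w \<bullet> y) else sgn (u \<bullet> y))" for y
  proof -
    have lim: "((\<lambda>e. (u + e *\<^sub>R w) \<bullet> y) \<longlongrightarrow> (u + 0 *\<^sub>R w) \<bullet> y) (at_right 0)"
      by (intro tendsto_intros)
    consider "u \<bullet> y = 0" | "u \<bullet> y > 0" | "u \<bullet> y < 0" by linarith
    then show ?thesis
    proof cases
      case 1
      then have "sgn ((u + e *\<^sub>R w) \<bullet> y) = sgn (w \<bullet> y)" if "e > 0" for e
        using that by (simp add: inner_add_left sgn_mult)
      then show ?thesis
        using 1 eventually_at_right_less[of "0::real"] by (auto elim: eventually_mono)
    next
      case 2
      then show ?thesis
        using order_tendstoD(1)[OF lim, of 0] by (auto elim!: eventually_mono)
    next
      case 3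
      then show ?thesis
        using order_tendstoD(2)[OF lim, of 0] by (auto elim!: eventually_mono)
    qed
  qed
  then have "\<forall>\<^sub>F e in at_right (0::real). \<forall>y\<in>F. sgn ((u + e *\<^sub>R w) \<bullet> y)
      = (if u \<bullet> y = 0 then sgn (w \<bullet> y) else sgn (u \<bullet> y))"
    using assms by (simp add: eventually_ball_finite)
  then have "\<forall>\<^sub>F e in at_right (0::real). e > 0 \<and> (\<forall>y\<in>F. sgn ((u + e *\<^sub>R w) \<bullet> y)
      = (if u \<bullet> y = 0 then sgn (w \<bullet> y) else sgn (u \<bullet> y)))"
    by (intro eventually_conj eventually_at_right_less)
  from eventually_happens'[OF _ this] show ?thesis
    by simp
qed

text \<open>Induction on \<open>F\<close>: the normal found so far is tilted towards the component
  of the new vector orthogonal to \<open>span S\<close>, which keeps it orthogonal to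
  \<open>S\<close> and keeps earlier nonzero products nonzero.\<close>

lemma generic_normal:
  fixes S :: "'a::euclidean_space set"
  assumes "finite F"
  shows "\<exists>u. (\<forall>s\<in>span S. u \<bullet> s = 0) \<and> (\<forall>y\<in>F - span S. u \<bullet> y \<noteq> 0)"
  using assms
proof (induction F)
  case empty
  show ?case by (auto intro: exI[of _ 0])
next
  case (insert y F)
  then obtain u where u: "\<forall>s\<in>span S. u \<bullet> s = 0" "\<forall>y\<in>F - span S. u \<bullet> y \<noteq> 0"
    by auto
  obtain a b where ab: "a \<in> span S" "\<And>w. w \<in> span S \<Longrightarrow> orthogonal b w" "y = a + b"
    using orthogonal_subspace_decomp_exists[of S y] by metis
  obtain e where "\<forall>z\<in>insert y F. sgn ((u + e *\<^sub>R b) \<bullet> z) = (if u \<bullet> z = 0 then sgn (b \<bullet> z) else sgn (u \<bullet> z))"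
    using tilt[of "insert y F" u b] insert.hyps by auto
  then obtain v where v: "\<forall>z\<in>insert y F. sgn (v \<bullet> z) = (if u \<bullet> z = 0 then sgn (b \<bullet> z) else sgn (u \<bullet> z))"
    and v_eq: "v = u + e *\<^sub>R b"
    by blast
  have "v \<bullet> s = 0" if "s \<in> span S" for s
    using u(1) ab(2)[OF that] that by (simp add: v_eq inner_add_left orthogonal_def)
  moreover have "v \<bullet> y \<noteq> 0" if "y \<notin> span S"
  proof -
    have "b \<bullet> a = 0" using ab by (simp add: orthogonal_def)
    moreover have "b \<noteq> 0" using ab that by auto
    ultimately have "b \<bullet> y \<noteq> 0" using ab(3) by (simp add: inner_add_right)
    with v show ?thesis by (metis insertI1 sgn_zero_iff)
  qed
  moreover have "v \<bullet> z \<noteq> 0" if "z \<in> F" "z \<notin> span S" for z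
    using v u(2) that by (metis DiffI insertI2 sgn_zero_iff)
  ultimately show ?case by blast
qed

text \<open>Indexing by \<open>I\<close> keeps multiplicities, since distinct points may project to
  the same vector.\<close>

lemma flat_count:
  fixes y :: "'i \<Rightarrow> 'a::euclidean_space"
  assumes fin: "finite I"
    and half: "\<And>u. card {i\<in>I. u \<bullet> y i > 0} \<le> h"
  shows "card I + 2 * card {i\<in>I. y i \<in> span S \<and> w \<bullet> y i > 0} \<le> 2 * h + card {i\<in>I. y i \<in> span S}"
proof -
  obtain u where u: "\<forall>s\<in>span S. u \<bullet> s = 0" "\<forall>z\<in>y ` I - span S. u \<bullet> z \<noteq> 0"
    using generic_normal[of "y ` I" S] fin by blast
  let ?C = "{i\<in>I. y i \<in> span S}"
  let ?D = "{i\<in>I. y i \<in> span S \<and> w \<bullet> y i > 0}"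
  \<comment> \<open>Tilting \<open>t\<close> towards \<open>w\<close> adds \<open>?D\<close> to the
    positive side and loses nothing. The same \<open>w\<close> serves both orientations, hence the
    factor 2.\<close>
  have side: "card {i\<in>I. t \<bullet> y i > 0} + card ?D \<le> h" if t: "t = u \<or> t = - u" for t
  proof -
    obtain v where v: "\<forall>z\<in>y ` I. sgn (v \<bullet> z) = (if t \<bullet> z = 0 then sgn (w \<bullet> z) else sgn (t \<bullet> z))"
      using tilt[of "y ` I" t w] fin by blast
    have "card {i\<in>I. t \<bullet> y i > 0} + card ?D = card ({i\<in>I. t \<bullet> y i > 0} \<union> ?D)"
      using u t fin by (intro card_Un_disjoint[symmetric]) auto
    also have "\<dots> \<le> card {i\<in>I. v \<bullet> y i > 0}"
    proof (intro card_mono)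
      show "{i\<in>I. t \<bullet> y i > 0} \<union> ?D \<subseteq> {i\<in>I. v \<bullet> y i > 0}"
        using v u(1) t by (force simp: sgn_if split: if_splits)
    qed (use fin in auto)
    finally show ?thesis using half[of v] by linarith
  qed
  have "I = {i\<in>I. u \<bullet> y i > 0} \<union> {i\<in>I. (- u) \<bullet> y i > 0} \<union> ?C"
    using u by force
  then have "card I = card ({i\<in>I. u \<bullet> y i > 0} \<union> {i\<in>I. (- u) \<bullet> y i > 0} \<union> ?C)"
    by simp
  also have "\<dots> \<le> card {i\<in>I. u \<bullet> y i > 0} + card {i\<in>I. (- u) \<bullet> y i > 0} + card ?C"
    by (intro order_trans[OF card_Un_le] add_right_mono card_Un_le)
  finally show ?thesis using side[of u] side[of "- u"] by simp
qed

section \<open>Lines in the even case\<close>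

text \<open>With \<open>card I = 2 * h\<close> each direction of the line holds at most half of its
  vectors, so both hold equally many. As \<open>i\<close> is on the line, the bound 3 leaves exactly
  one in each direction.\<close>

lemma antipodal_partner:
  fixes y :: "'i \<Rightarrow> 'a::euclidean_space"
  assumes fin: "finite I"
    and half: "\<And>u. card {i\<in>I. u \<bullet> y i > 0} \<le> h"
    and nz: "\<And>i. i \<in> I \<Longrightarrow> y i \<noteq> 0"
    and cardI: "card I = 2 * h"
    and line: "\<And>i. i \<in> I \<Longrightarrow> card {j\<in>I. y j \<in> span {y i}} \<le> 3"
    and i: "i \<in> I"
  obtains j s where "j \<in> I" "j \<noteq> i" "{j\<in>I. y j \<in> span {y i}} = {i, j}" "s > 0" "y j = - s *\<^sub>R y i"
proof -
  let ?C = "{j\<in>I. y j \<in> span {y i}}"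
  let ?D = "\<lambda>w. {j\<in>I. y j \<in> span {y i} \<and> w \<bullet> y j > 0}"
  have le: "2 * card (?D w) \<le> card ?C" for w
    using flat_count[OF fin half, of "{y i}" w] cardI by simp
  have "y i \<bullet> y j \<noteq> 0" if "j \<in> ?C" for j
    using that nz[OF i] nz[of j] by (auto simp: span_singleton)
  then have C: "?C = ?D (y i) \<union> ?D (- y i)"
    by force
  also have "card \<dots> = card (?D (y i)) + card (?D (- y i))"
    using fin by (intro card_Un_disjoint) auto
  finally have card_C: "card ?C = card (?D (y i)) + card (?D (- y i))" .
  have "i \<in> ?D (y i)"
    using i nz[OF i] by (simp add: span_base)
  then have "card (?D (y i)) > 0"
    using fin by (auto simp: card_gt_0_iff)
  then have card_1: "card (?D (y i)) = 1" "card (?D (- y i)) = 1"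
    using le[of "y i"] le[of "- y i"] line[OF i] card_C by linarith+
  obtain l where l: "?D (y i) = {l}"
    using card_1(1) by (rule card_1_singletonE)
  obtain j where j: "?D (y i) = {i}" "?D (- y i) = {j}"
    using card_1(2) \<open>i \<in> ?D (y i)\<close> unfolding l by (elim card_1_singletonE) blast
  from j(2) have "j \<in> ?D (- y i)" by blast
  then have "j \<in> I" "y j \<in> span {y i}" "y i \<bullet> y j < 0"
    by simp_all
  then obtain c where c: "j \<in> I" "y j = c *\<^sub>R y i" "y i \<bullet> y j < 0"
    unfolding span_singleton by blast
  then have "c < 0"
    using inner_ge_zero[of "y i"] by (auto simp: mult_less_0_iff)
  moreover have "j \<noteq> i"
    using c(3) inner_ge_zero[of "y i"] by (metis not_less)
  moreover have "?C = {i, j}"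
    using C j by auto
  ultimately show thesis
    using c by (intro that[of j "- c"]) auto
qed

section \<open>The odd case: two-coloured triples\<close>

text \<open>An ordered pair \<open>(a, b)\<close> of one colour is sent to the two-coloured pair
  formed by \<open>a\<close> and the third point of its line. Injectivity gives p(p - 1) + q(q - 1)
  <= pq for the colour sizes p and q, hence p + q <= 4.\<close>

lemma two_coloured_triples:
  fixes line :: "'i \<Rightarrow> 'i \<Rightarrow> 'i set"
  assumes fin: "finite P" "finite Q" and disj: "P \<inter> Q = {}"
    and fin_line: "\<And>a b. finite (line a b)"
    and triple: "\<And>a b. \<lbrakk>a \<in> P \<union> Q; b \<in> P \<union> Q; a \<noteq> b\<rbrakk> \<Longrightarrow> a \<in> line a b \<and> b \<in> line a b \<and> card (line a b) \<le> 3"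
    and exchange: "\<And>a b c d. \<lbrakk>a \<in> P \<union> Q; b \<in> P \<union> Q; c \<in> P \<union> Q; d \<in> P \<union> Q; a \<noteq> b; c \<noteq> d;
        c \<in> line a b; d \<in> line a b\<rbrakk> \<Longrightarrow> line c d = line a b"
    and third_P: "\<And>a b. \<lbrakk>a \<in> P; b \<in> P; a \<noteq> b\<rbrakk> \<Longrightarrow> \<exists>t\<in>Q. t \<in> line a b"
    and third_Q: "\<And>a b. \<lbrakk>a \<in> Q; b \<in> Q; a \<noteq> b\<rbrakk> \<Longrightarrow> \<exists>t\<in>P. t \<in> line a b"
  shows "card P + card Q \<le> 4"
proof -
  have "\<exists>t. \<forall>a b. a \<noteq> b \<longrightarrow> (a \<in> P \<and> b \<in> P \<longrightarrow> t a b \<in> Q \<inter> line a b) \<and> (a \<in> Q \<and> b \<in> Q \<longrightarrow> t a b \<in> P \<inter> line a b)"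
    using third_P third_Q disj by (intro choice allI) (metis IntI disjoint_iff)
  then obtain t where t: "\<And>a b. \<lbrakk>a \<in> P; b \<in> P; a \<noteq> b\<rbrakk> \<Longrightarrow> t a b \<in> Q \<inter> line a b"
    "\<And>a b. \<lbrakk>a \<in> Q; b \<in> Q; a \<noteq> b\<rbrakk> \<Longrightarrow> t a b \<in> P \<inter> line a b"
    by metis
  define pairs where "pairs = (\<lambda>A. SIGMA a:A. A - {a :: 'i})"
  have card_pairs: "card (pairs A) = card A * (card A - 1)" if "finite A" for A
    using that by (simp add: pairs_def)
  define f where "f = (\<lambda>(a, b). if a \<in> P then (a, t a b) else (t a b, a))"
  \<comment> \<open>The third point has the other colour, so it differs from \<open>a\<close> and
    \<open>b\<close>, and the three points exhaust the line.\<close>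
  have line_eq: "line a b = {a, b, t a b}" and t_dist: "t a b \<in> P \<union> Q" "t a b \<noteq> a" "t a b \<noteq> b"
    if "(a, b) \<in> pairs P \<union> pairs Q" for a b
  proof -
    show dist: "t a b \<in> P \<union> Q" "t a b \<noteq> a" "t a b \<noteq> b"
      using that t[of a b] disj by (auto simp: pairs_def)
    have "card {a, b, t a b} = 3"
      using that dist by (auto simp: pairs_def)
    moreover have "{a, b, t a b} \<subseteq> line a b" "card (line a b) \<le> 3"
      using that t[of a b] triple[of a b] by (auto simp: pairs_def)
    ultimately show "line a b = {a, b, t a b}"
      using card_seteq[OF fin_line, of "{a, b, t a b}" a b] by simp
  qed
  have "inj_on f (pairs P \<union> pairs Q)"
  proof (rule inj_onI)
    fix p p' assume p: "p \<in> pairs P \<union> pairs Q" "p' \<in> pairs P \<union> pairs Q" "f p = f p'"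
    obtain a b a' b' where ab: "p = (a, b)" "p' = (a', b')"
      by (metis surj_pair)
    have "a \<in> P \<union> Q" "b \<in> P \<union> Q" "a \<noteq> b" "a' \<in> P \<union> Q" "b' \<in> P \<union> Q" "a' \<noteq> b'"
      using p ab by (auto simp: pairs_def)
    moreover have "{a, t a b} = {a', t a' b'}"
      using p(3) by (auto simp: ab f_def split: if_splits)
    ultimately have "line a b = line a' b'"
      using exchange[of a b a "t a b"] exchange[of a' b' a' "t a' b'"]
        exchange[of a' b' a "t a b"] line_eq[of a b] line_eq[of a' b'] t_dist[of a b] t_dist[of a' b'] p ab
      by (metis insertCI insert_commute)
    \<comment> \<open>The point of the line missing from the image pair is \<open>b\<close>. Its
      colour is that of \<open>a\<close>, so it also tells which component of the image is
      \<open>a\<close>.\<close>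
    then have "{a, b, t a b} = {a', b', t a' b'}"
      using line_eq p ab by simp
    then show "p = p'"
      using p t[of a b] t[of a' b'] disj by (auto simp: ab f_def pairs_def split: if_splits)
  qed
  moreover have "f ` (pairs P \<union> pairs Q) \<subseteq> P \<times> Q"
  proof (rule image_subsetI)
    fix p assume p: "p \<in> pairs P \<union> pairs Q"
    obtain a b where ab: "p = (a, b)"
      by (metis surj_pair)
    from p ab consider "a \<in> P" "b \<in> P" "a \<noteq> b" | "a \<in> Q" "b \<in> Q" "a \<noteq> b" "a \<notin> P"
      using disj by (auto simp: pairs_def)
    then show "f p \<in> P \<times> Q"
      using t[of a b] by cases (auto simp: ab f_def)
  qed
  ultimately have "card (pairs P \<union> pairs Q) \<le> card (P \<times> Q)"
    using fin by (intro card_inj_on_le) auto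
  moreover have "card (pairs P \<union> pairs Q) = card (pairs P) + card (pairs Q)"
    using fin disj by (intro card_Un_disjoint) (auto simp: pairs_def)
  ultimately have "card P * (card P - 1) + card Q * (card Q - 1) \<le> card P * card Q"
    using fin by (simp add: card_pairs)
  then have "int (card P * (card P - 1) + card Q * (card Q - 1)) \<le> int (card P * card Q)"
    by (rule zle_int[THEN iffD2])
  moreover have "int (n * (n - 1)) = int n * int n - int n" for n :: nat
    by (cases n) (auto simp: algebra_simps)
  ultimately have "int (card P) * int (card P) - int (card P) + (int (card Q) * int (card Q) - int (card Q))
      \<le> int (card P) * int (card Q)"
    by simp
  \<comment> \<open>Used through 4(p^2 + q^2 - pq) = (p + q)^2 + 3(p - q)^2.\<close>
  moreover have "0 \<le> (int (card P) - int (card Q))\<^sup>2"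
    by simp
  ultimately have "(int (card P) + int (card Q)) * (int (card P) + int (card Q))
      \<le> 4 * (int (card P) + int (card Q))"
    by (simp add: power2_eq_square algebra_simps)
  then have "int (card P) + int (card Q) \<le> 4"
    using mult_right_le_imp_le by (cases "int (card P) + int (card Q) > 0") (blast, linarith)
  then show ?thesis by linarith
qed

text \<open>Supplies the exchange property of planes. The span of \<open>a\<close> and
  \<open>b\<close> has dimension at most 2, and \<open>c\<close> and \<open>d\<close> already reach
  it.\<close>

lemma span_pair_eq:
  fixes a b c d :: "'a::euclidean_space"
  assumes "c \<in> span {a, b}" "d \<in> span {a, b}" "d \<notin> span {c}" "c \<noteq> 0"
  shows "span {c, d} = span {a, b}"
proof (rule subspace_dim_equal)
  show "span {c, d} \<subseteq> span {a, b}"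
    using assms by (intro span_minimal) auto
  have "independent {d, c}"
    using assms by (simp add: independent_insert)
  moreover have "d \<noteq> c"
    using assms by (auto simp: span_base)
  ultimately have "dim {d, c} = 2"
    by (simp add: dim_eq_card_independent)
  moreover have "dim {a, b} \<le> card {a, b}"
    by (intro dim_le_card') auto
  moreover have "card {a, b} \<le> 2"
    by (simp add: card_insert_if)
  ultimately show "dim (span {a, b}) \<le> dim (span {c, d})"
    by (simp add: insert_commute)
qed auto

text \<open>The vectors are coloured by their side of a generic hyperplane, with planes as lines of
  \<open>two_coloured_triples\<close>. Since \<open>h >= 4\<close> there are at least 7 vectors, so
  5 remain even after one parallel pair is removed.\<close>

lemma no_odd_balanced_configuration:
  fixes y :: "'i \<Rightarrow> 'a::euclidean_space"
  assumes fin: "finite I"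
    and half: "\<And>u. card {i\<in>I. u \<bullet> y i > 0} \<le> h"
    and nz: "\<And>i. i \<in> I \<Longrightarrow> y i \<noteq> 0"
    and cardI: "card I + 1 = 2 * h"
    and plane: "\<And>i j. \<lbrakk>i \<in> I; j \<in> I\<rbrakk> \<Longrightarrow> card {l\<in>I. y l \<in> span {y i, y j}} \<le> 3"
    and h: "h \<ge> 4"
  shows False
proof -
  let ?C = "\<lambda>i j. {l\<in>I. y l \<in> span {y i, y j}}"
  have line_sym: "y i \<in> span {y j}" if "y j \<in> span {y i}" "j \<in> I" for i j
    using that nz[of j] in_span_insert[of "y j" "y i" "{}"] by auto
  \<comment> \<open>If \<open>i\<close> and \<open>j\<close> are parallel, they are dropped. A
    second parallel pair, or a plane through two remaining vectors that contains \<open>y i\<close>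
    or \<open>y j\<close>, would give a plane with four vectors.\<close>
  obtain Z where Z: "Z \<subseteq> I" "card Z \<ge> 5" "\<And>a b. \<lbrakk>a \<in> Z; b \<in> Z; a \<noteq> b\<rbrakk> \<Longrightarrow> y b \<notin> span {y a}"
    "\<And>a b. \<lbrakk>a \<in> Z; b \<in> Z; a \<noteq> b\<rbrakk> \<Longrightarrow> ?C a b \<subseteq> Z"
  proof (cases "\<exists>i\<in>I. \<exists>j\<in>I. i \<noteq> j \<and> y j \<in> span {y i}")
    case False
    then show ?thesis
      using h cardI by (intro that[of I]) auto
  next
    case True
    then obtain i j where ij: "i \<in> I" "j \<in> I" "i \<noteq> j" "y j \<in> span {y i}"
      by blast
    have 4: False if "{i, j, a, b} \<subseteq> ?C c d" "a \<in> I - {i, j}" "b \<in> I - {i, j}" "a \<noteq> b" "c \<in> I" "d \<in> I" for a b c d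
    proof -
      have "card {i, j, a, b} \<le> card (?C c d)"
        using fin that by (intro card_mono) auto
      moreover have "card {i, j, a, b} = 4"
        using ij that by auto
      ultimately show False
        using plane[of c d] that by linarith
    qed
    show ?thesis
    proof (rule that[of "I - {i, j}"])
      have "card (I - {i, j}) = card I - 2"
        using ij fin by (simp add: card_Diff_subset)
      then show "card (I - {i, j}) \<ge> 5"
        using h cardI by simp
      show "y b \<notin> span {y a}" if "a \<in> I - {i, j}" "b \<in> I - {i, j}" "a \<noteq> b" for a b
      proof
        assume "y b \<in> span {y a}"
        then have "{i, j, a, b} \<subseteq> ?C i a"
          using that ij span_mono[of "{y i}" "{y i, y a}"] span_mono[of "{y a}" "{y i, y a}"]
          by (auto intro: span_base)
        then show False
          using 4 that ij by blast
      qed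
      show "?C a b \<subseteq> I - {i, j}" if "a \<in> I - {i, j}" "b \<in> I - {i, j}" "a \<noteq> b" for a b
      proof (rule ccontr)
        assume "\<not> ?C a b \<subseteq> I - {i, j}"
        then have "y i \<in> span {y a, y b} \<or> y j \<in> span {y a, y b}"
          by auto
        moreover have "y i \<in> span {y j}"
          using line_sym ij by blast
        ultimately have "y i \<in> span {y a, y b} \<and> y j \<in> span {y a, y b}"
          using ij span_minimal[of "{y i}" "span {y a, y b}"] span_minimal[of "{y j}" "span {y a, y b}"]
          by auto
        then have "{i, j, a, b} \<subseteq> ?C a b"
          using that ij by (auto intro: span_base)
        then show False
          using 4 that by blast
      qed
    qed auto
  qed
  obtain u where u: "\<forall>z\<in>y ` I - span {}. u \<bullet> z \<noteq> 0"
    using generic_normal[of "y ` I" "{}"] fin by blast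
  define P where "P = (\<lambda>w. {z\<in>Z. w \<bullet> y z > 0})"
  have finZ: "finite Z"
    using Z(1) fin finite_subset by blast
  have u_nz: "u \<bullet> y i \<noteq> 0" if "i \<in> I" for i
    using u nz that by auto
  have PQ: "Z = P u \<union> P (- u)"
    using u_nz Z(1) by (force simp: P_def)
  have third: "\<exists>t\<in>P (- w). t \<in> ?C a b \<inter> Z"
    if "a \<in> P w" "b \<in> P w" "a \<noteq> b" "w = u \<or> w = - u" for a b w
  proof -
    let ?D = "{l\<in>I. y l \<in> span {y a, y b} \<and> w \<bullet> y l > 0}"
    have ab: "a \<in> Z" "b \<in> Z"
      using that by (auto simp: P_def)
    have "{a, b} \<subseteq> ?D"
      using that Z(1) by (auto simp: P_def span_base)
    then have "card {a, b} \<le> card ?D"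
      using fin by (intro card_mono) auto
    then have "card ?D \<ge> 2"
      using that by simp
    moreover have "card I + 2 * card ?D \<le> 2 * h + card (?C a b)"
      by (rule flat_count[OF fin half])
    moreover have "card (?C a b) \<le> 3"
      using plane ab Z(1) by blast
    \<comment> \<open>If all c vectors of the plane were on one side, then 2c <= c + 1, although c
      >= 2.\<close>
    ultimately have "card ?D \<noteq> card (?C a b)"
      using cardI by linarith
    then have "?D \<noteq> ?C a b"
      by metis
    then obtain t where t: "t \<in> ?C a b" "\<not> w \<bullet> y t > 0"
      by blast
    then have "t \<in> Z"
      using Z(4) ab that by blast
    moreover have "w \<bullet> y t \<noteq> 0"
      using u_nz[of t] t that by auto
    ultimately show ?thesis
      using t by (auto simp: P_def)
  qed
  have "card (P u) + card (P (- u)) \<le> 4"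
  proof (rule two_coloured_triples[where line = "\<lambda>a b. ?C a b \<inter> Z"])
    show "finite (P u)" "finite (P (- u))"
      using finZ by (auto simp: P_def)
    show "P u \<inter> P (- u) = {}"
      by (auto simp: P_def)
    show "finite (?C a b \<inter> Z)" for a b
      using finZ by blast
    show "a \<in> ?C a b \<inter> Z \<and> b \<in> ?C a b \<inter> Z \<and> card (?C a b \<inter> Z) \<le> 3"
      if "a \<in> P u \<union> P (- u)" "b \<in> P u \<union> P (- u)" "a \<noteq> b" for a b
    proof -
      have "card (?C a b \<inter> Z) \<le> card (?C a b)"
        using fin by (intro card_mono) auto
      also have "\<dots> \<le> 3"
        using that PQ Z(1) by (intro plane) auto
      finally show ?thesis
        using that PQ Z(1) by (auto simp: span_base)
    qed
    show "?C c d \<inter> Z = ?C a b \<inter> Z" if "c \<in> ?C a b \<inter> Z" "d \<in> ?C a b \<inter> Z" "c \<noteq> d" for a b c d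
      using that span_pair_eq[of "y c" "y a" "y b" "y d"] Z(3) nz[of c] by simp
    show "\<exists>t\<in>P (- u). t \<in> ?C a b \<inter> Z" if "a \<in> P u" "b \<in> P u" "a \<noteq> b" for a b
      using third[of a u b] that by blast
    show "\<exists>t\<in>P u. t \<in> ?C a b \<inter> Z" if "a \<in> P (- u)" "b \<in> P (- u)" "a \<noteq> b" for a b
      using third[of a "- u" b] that by simp
  qed
  moreover have "card Z \<le> card (P u) + card (P (- u))"
    by (subst PQ) (rule card_Un_le)
  ultimately show False
    using Z(2) by linarith
qed

section \<open>Matching in the even case\<close>

text \<open>The blocks are the classes of parallel vectors, which \<open>antipodal_partner\<close>
  shows to be antipodal pairs.\<close>

lemma antipodal_matching:
  fixes y :: "'i \<Rightarrow> 'a::euclidean_space"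
  assumes fin: "finite I"
    and half: "\<And>u. card {i\<in>I. u \<bullet> y i > 0} \<le> h"
    and nz: "\<And>i. i \<in> I \<Longrightarrow> y i \<noteq> 0"
    and cardI: "card I = 2 * h"
    and line: "\<And>i. i \<in> I \<Longrightarrow> card {j\<in>I. y j \<in> span {y i}} \<le> 3"
  obtains M where "pair_matching I M" "card M = h"
    "\<And>a b. {a, b} \<in> M \<Longrightarrow> \<exists>s>0. y b = - s *\<^sub>R y a"
proof -
  define cls where "cls = (\<lambda>i. {j\<in>I. y j \<in> span {y i}})"
  define M where "M = cls ` I"
  have partner: "\<exists>j s. j \<in> I \<and> j \<noteq> i \<and> cls i = {i, j} \<and> s > 0 \<and> y j = - s *\<^sub>R y i" if i: "i \<in> I" for i
    by (rule antipodal_partner[OF fin half nz cardI line i]) (auto simp: cls_def)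
  have cls_eq: "cls j = cls i" if "i \<in> I" "j \<in> cls i" for i j
  proof -
    have "y j \<in> span {y i}" "y j \<noteq> 0"
      using that nz by (auto simp: cls_def)
    then have "y i \<in> span {y j}"
      using in_span_insert[of "y j" "y i" "{}"] by simp
    then have "span {y j} = span {y i}"
      using \<open>y j \<in> span {y i}\<close> by (intro equalityI span_minimal) auto
    then show ?thesis
      by (simp add: cls_def)
  qed
  have self: "i \<in> cls i" if "i \<in> I" for i
    using that by (simp add: cls_def span_base)
  have part: "partition_on I M"
  proof (rule partition_onI)
    show "\<Union> M = I"
      using self by (auto simp: M_def cls_def)
    show "disjnt p p'" if "p \<in> M" "p' \<in> M" "p \<noteq> p'" for p p'
      using that cls_eq unfolding M_def disjnt_iff by blast
    show "{} \<notin> M"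
      using self by (auto simp: M_def)
  qed
  have card2: "card p = 2" if "p \<in> M" for p
  proof -
    from that obtain i where i: "i \<in> I" "p = cls i"
      by (auto simp: M_def)
    with partner[OF i(1)] show ?thesis
      by auto
  qed
  have "2 * card M = card (\<Union> M)"
  proof (rule card_partition)
    show "finite M" "finite (\<Union> M)"
      using fin by (auto simp: M_def cls_def)
    show "p \<inter> p' = {}" if "p \<in> M" "p' \<in> M" "p \<noteq> p'" for p p'
      using part that by (metis disjointD partition_onD2)
  qed (rule card2)
  then have "card M = h"
    using part cardI by (simp add: partition_on_def)
  moreover have "\<exists>s>0. y b = - s *\<^sub>R y a" if "{a, b} \<in> M" for a b
  proof -
    from that obtain i where i: "i \<in> I" "{a, b} = cls i"
      by (auto simp: M_def)
    then have "a \<in> I"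
      by (auto simp: cls_def)
    moreover have "cls a = {a, b}"
      using cls_eq[of i a] i by auto
    ultimately obtain j s where "{a, b} = {a, j}" "j \<noteq> a" "s > 0" "y j = - s *\<^sub>R y a"
      using partner[of a] by metis
    then show ?thesis
      by (metis doubleton_eq_iff)
  qed
  ultimately show thesis
    using part card2 by (intro that[of M]) (auto simp: pair_matching_def)
qed

section \<open>Projection along a flat and general position\<close>

text \<open>\<open>g\<close> subtracts the orthogonal projection onto \<open>S\<close>. Its values
  stay in the ambient space, which thus models the quotient by \<open>S\<close>.\<close>

lemma linear_with_kernel:
  fixes S :: "'a::euclidean_space set"
  assumes "subspace S"
  obtains g :: "'a \<Rightarrow> 'a" where "linear g" "\<And>x. g x = 0 \<longleftrightarrow> x \<in> S"
proof -
  obtain B where B: "B \<subseteq> S" "pairwise orthogonal B" "span B = S"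
    using orthonormal_basis_subspace[OF assms] by metis
  define g where "g = (\<lambda>x. x - (\<Sum>b\<in>B. (b \<bullet> x / (b \<bullet> b)) *\<^sub>R b))"
  have proj: "(\<Sum>b\<in>B. (b \<bullet> x / (b \<bullet> b)) *\<^sub>R b) \<in> S" for x
    using B(1) assms by (intro subspace_sum subspace_scale) auto
  have "linear g"
    unfolding g_def
    by (rule linearI)
      (simp_all add: inner_add_right add_divide_distrib scaleR_add_left sum.distrib scaleR_sum_right scaleR_diff_right)
  moreover have "g x = 0 \<longleftrightarrow> x \<in> S" for x
  proof
    assume "g x = 0"
    then show "x \<in> S"
      using proj[of x] by (simp add: g_def)
  next
    assume "x \<in> S"
    then have "g x \<in> S"
      using proj assms by (simp add: g_def subspace_diff)
    \<comment> \<open>The Gram-Schmidt residual is orthogonal to all of \<open>S\<close>, in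
      particular to itself.\<close>
    then have "orthogonal (g x) (g x)"
      using Gram_Schmidt_step[OF B(2), of "g x" x] unfolding B(3) g_def by blast
    then show "g x = 0"
      by (simp add: orthogonal_self)
  qed
  ultimately show thesis
    using that by blast
qed

text \<open>One point more than the bound still makes at most \<open>DIM('a) + 1\<close> points,
  hence an affinely independent set, too large for the dimension of \<open>A\<close>.\<close>

lemma general_position_card_Int_le:
  fixes X A :: "'a::euclidean_space set"
  assumes gp: "general_position X" and A: "aff_dim A < int DIM('a)"
  shows "int (card (X \<inter> A)) \<le> aff_dim A + 1"
proof (rule ccontr)
  assume "\<not> ?thesis"
  then have "nat (aff_dim A + 2) \<le> card (X \<inter> A)"
    by linarith
  then obtain S where S: "S \<subseteq> X \<inter> A" "card S = nat (aff_dim A + 2)" "finite S"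
    by (rule obtain_subset_with_card_n)
  moreover have card_S: "int (card S) = aff_dim A + 2"
    using S(2) aff_dim_geq[of A] by simp
  ultimately have "\<not> affine_dependent S"
    using gp A unfolding general_position_def by simp
  then have "aff_dim S = aff_dim A + 1"
    using card_S by (simp add: affine_independent_iff_card)
  moreover have "aff_dim S \<le> aff_dim A"
    using S(1) by (intro aff_dim_subset) auto
  ultimately show False
    by simp
qed

text \<open>The hull of \<open>k\<close> points in the open half-space stays inside it, while
  \<open>L\<close> misses it because \<open>g (x - p)\<close> vanishes there.\<close>

lemma k_sets_transversal_halfspace_card:
  fixes g :: "'a::euclidean_space \<Rightarrow> 'a"
  assumes trans: "transversal_to L ((\<lambda>S. convex hull S) ` k_sets k X)"
    and g: "linear g" "\<And>x. x \<in> L \<Longrightarrow> g (x - p) = 0"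
    and k: "k > 0"
  shows "card {x\<in>X. u \<bullet> g (x - p) > 0} \<le> k - 1"
proof (rule ccontr)
  let ?H = "{x. u \<bullet> g (x - p) > 0}"
  assume "\<not> ?thesis"
  then have "k \<le> card {x\<in>X. u \<bullet> g (x - p) > 0}"
    by linarith
  then obtain K where K: "K \<subseteq> {x\<in>X. u \<bullet> g (x - p) > 0}" "card K = k" "finite K"
    by (rule obtain_subset_with_card_n)
  then have "K \<in> k_sets k X"
    by (auto simp: k_sets_def)
  then obtain z where z: "z \<in> L" "z \<in> convex hull K"
    using trans by (auto simp: transversal_to_def)
  have "?H = g -` {z. u \<bullet> z > u \<bullet> g p}"
    using g(1) by (auto simp: linear_diff inner_diff_right)
  then have "convex ?H"
    using convex_linear_vimage[OF g(1) convex_halfspace_gt] by metis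
  then have "convex hull K \<subseteq> ?H"
    using K(1) by (intro hull_minimal) auto
  then show False
    using z g(2)[of z] by auto
qed

text \<open>Subtracting the right multiples of \<open>a - p\<close> and \<open>b - p\<close> from
  \<open>x\<close> leads into \<open>L\<close>. This turns bounds on points in flats into bounds on
  vectors in spans.\<close>

lemma span_projection_subset_affine_hull:
  fixes g :: "'a::euclidean_space \<Rightarrow> 'a"
  assumes g: "linear g" "\<And>x. g (x - p) = 0 \<longleftrightarrow> x \<in> L" and p: "p \<in> L"
    and x: "g (x - p) \<in> span {g (a - p), g (b - p)}"
  shows "x \<in> affine hull (insert a (insert b L))"
proof -
  let ?A = "affine hull (insert a (insert b L))"
  obtain \<alpha> \<beta> where "g (x - p) = \<alpha> *\<^sub>R g (a - p) + \<beta> *\<^sub>R g (b - p)"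
    using x unfolding span_breakdown_eq span_empty by (metis add.commute diff_eq_eq singletonD eq_iff_diff_eq_0)
  then have "g ((x - \<alpha> *\<^sub>R (a - p) - \<beta> *\<^sub>R (b - p)) - p) = 0"
    using g(1) by (simp add: linear_add linear_diff linear_scale algebra_simps)
  then have "x - \<alpha> *\<^sub>R (a - p) - \<beta> *\<^sub>R (b - p) \<in> ?A"
    using g(2) by (meson hull_inc insertCI)
  moreover have "a \<in> ?A" "b \<in> ?A" "p \<in> ?A"
    using p by (auto intro: hull_inc)
  ultimately have "x - \<alpha> *\<^sub>R (a - p) - \<beta> *\<^sub>R (b - p) + \<beta> *\<^sub>R (b - p) + \<alpha> *\<^sub>R (a - p) \<in> ?A"
    by (intro mem_affine_3_minus affine_affine_hull)
  then show ?thesis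
    by simp
qed

section \<open>Assembly of the two cases\<close>

theorem theorem2p5:
  fixes X L :: "(real ^ 'd) set" and lam k :: nat
  assumes "lam \<in> {2, 3}"
    and "k \<ge> lam + 2"
    and "CARD('d) \<ge> lam"
    and "finite X"
    and "card X = CARD('d) + 2 * (k - lam)"
    and "general_position X"
    and "kneser_transversal lam k X L"
  shows "complete_kneser_transversal lam k X L \<or>
    (int (card (X \<inter> L)) = int CARD('d) - 2 * (int lam - 1) \<and>
     card (X - L) = 2 * (k - 1) \<and>
     (\<exists>M. pair_matching (X - L) M \<and> card M = k - 1 \<and>
        (\<forall>a b. {a, b} \<in> M \<longrightarrow> closed_segment a b \<inter> L \<noteq> {})))"
proof (cases "complete_kneser_transversal lam k X L")
  case False
  let ?d = "CARD('d)"
  have L: "affine L" "aff_dim L = int ?d - int lam"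
    and trans: "transversal_to L ((\<lambda>S. convex hull S) ` k_sets k X)"
    using assms(3,7) by (auto simp: kneser_transversal_def is_plane_def of_nat_diff)
  have "L \<noteq> {}"
    using L(2) assms(3) by auto
  then obtain p where p: "p \<in> L"
    by blast
  obtain g :: "real ^ 'd \<Rightarrow> real ^ 'd" where g: "linear g"
    and ker: "\<And>x. g x = 0 \<longleftrightarrow> x \<in> (\<lambda>x. x - p) ` L"
    using linear_with_kernel[OF affine_diffs_subspace_subtract[OF L(1) p]] by blast
  define y where "y = (\<lambda>x. g (x - p))"
  have y0: "g (x - p) = 0 \<longleftrightarrow> x \<in> L" for x
    unfolding ker by force
  let ?I = "X - L"
  have finI: "finite ?I"
    using assms(4) by simp
  have nz: "y x \<noteq> 0" if "x \<in> ?I" for x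
    using that y0 by (simp add: y_def)
  have half: "card {x\<in>?I. u \<bullet> y x > 0} \<le> k - 1" for u
  proof -
    have "card {x\<in>?I. u \<bullet> y x > 0} \<le> card {x\<in>X. u \<bullet> y x > 0}"
      using assms(4) by (intro card_mono) auto
    also have "\<dots> \<le> k - 1"
      unfolding y_def using assms(2) y0 by (intro k_sets_transversal_halfspace_card[OF trans g]) auto
    finally show ?thesis .
  qed
  have "card X = card (X \<inter> L) + card ?I"
    using assms(4) by (simp add: card_Int_Diff)
  then have card_I: "int (card ?I) = int ?d + 2 * (int k - int lam) - int (card (X \<inter> L))"
    using assms(2,5) by (simp add: of_nat_diff)
  \<comment> \<open>Taking \<open>a = b\<close> gives the version for lines.\<close>
  have flat: "int (card {x\<in>?I. y x \<in> span {y a, y b}}) + int (card (X \<inter> L)) \<le> aff_dim (insert a (insert b L)) + 1"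
    if "aff_dim (insert a (insert b L)) < int ?d" for a b
  proof -
    let ?A = "affine hull (insert a (insert b L))"
    let ?F = "{x\<in>?I. y x \<in> span {y a, y b}}"
    have "?F \<subseteq> ?A"
      using span_projection_subset_affine_hull[OF g y0 p] by (auto simp: y_def)
    moreover have "L \<subseteq> ?A"
      by (meson hull_subset insert_subset order_trans)
    ultimately have "?F \<union> (X \<inter> L) \<subseteq> X \<inter> ?A"
      by blast
    then have "card (?F \<union> (X \<inter> L)) \<le> card (X \<inter> ?A)"
      using assms(4) by (intro card_mono) auto
    moreover have "card (?F \<union> (X \<inter> L)) = card ?F + card (X \<inter> L)"
      using assms(4) by (intro card_Un_disjoint) auto
    moreover have "int (card (X \<inter> ?A)) \<le> aff_dim ?A + 1"
      using that by (intro general_position_card_Int_le assms(6)) simp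
    ultimately show ?thesis
      by simp
  qed
  have "int (card (X \<inter> L)) \<le> int ?d - int lam + 1"
    using general_position_card_Int_le[OF assms(6), of L] L(2) assms(1) by auto
  moreover have "card (X \<inter> L) \<noteq> ?d - lam + 1"
    using False assms(7) by (simp add: complete_kneser_transversal_def)
  ultimately have XL_le: "int (card (X \<inter> L)) \<le> int ?d - int lam"
    using assms(3) by linarith
  have origin: "{x\<in>?I. y x \<in> span {}} = {}"
    using nz by auto
  have I_le: "card ?I \<le> 2 * (k - 1)"
    using flat_count[OF finI half, of "{}" 0] unfolding origin by simp
  have I_eq: "card ?I = 2 * (k - 1)"
  proof (rule ccontr)
    assume "card ?I \<noteq> 2 * (k - 1)"
    \<comment> \<open>For \<open>lam = 2\<close> this is already the upper bound 2(k - 1); for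
      \<open>lam = 3\<close> it is one less, which leaves only the odd case.\<close>
    moreover have "int (card ?I) \<ge> 2 * int k - int lam"
      using card_I XL_le by simp
    moreover have "lam = 2 \<or> lam = 3"
      using assms(1) by simp
    ultimately have lam: "lam = 3" and I: "card ?I + 1 = 2 * (k - 1)"
      using I_le assms(2) by linarith+
    have "card {x\<in>?I. y x \<in> span {y a, y b}} \<le> 3" for a b
    proof -
      \<comment> \<open>Such a flat has at most d points of \<open>X\<close>. Here \<open>L\<close>
        contains d - 3 of them, so three are left.\<close>
      have "aff_dim (insert a (insert b L)) \<le> int ?d - 1"
        using L(2) lam by (auto simp: aff_dim_insert)
      then have "int (card {x\<in>?I. y x \<in> span {y a, y b}}) + int (card (X \<inter> L)) \<le> int ?d"
        using flat[of a b] by simp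
      then show ?thesis
        using card_I I assms(2) lam by simp
    qed
    moreover have "k - 1 \<ge> 4"
      using assms(2) lam by simp
    ultimately show False
      using no_odd_balanced_configuration[OF finI half nz I] by blast
  qed
  have XL: "int (card (X \<inter> L)) = int ?d - 2 * (int lam - 1)"
    using I_eq card_I assms(2) by simp
  have line: "card {x\<in>?I. y x \<in> span {y a}} \<le> 3" for a
  proof -
    \<comment> \<open>At most d - lam + 2 points of \<open>X\<close> lie in this flat and d - 2(lam
      - 1) of them in \<open>L\<close>, which leaves at most \<open>lam\<close>.\<close>
    have "aff_dim (insert a (insert a L)) \<le> int ?d - int lam + 1"
      using L(2) by (auto simp: aff_dim_insert)
    then show ?thesis
      using flat[of a a] XL assms(1) by auto
  qed
  obtain M where M: "pair_matching ?I M" "card M = k - 1"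
    "\<And>a b. {a, b} \<in> M \<Longrightarrow> \<exists>s>0. y b = - s *\<^sub>R y a"
    using antipodal_matching[OF finI half nz I_eq line] by blast
  have "closed_segment a b \<inter> L \<noteq> {}" if "{a, b} \<in> M" for a b
  proof -
    obtain s where s: "s > 0" "y b = - s *\<^sub>R y a"
      using M(3) \<open>{a, b} \<in> M\<close> by blast
    \<comment> \<open>Chosen so that (1 - t) \<open>y a\<close> + t \<open>y b\<close> vanishes,
      which puts the corresponding point of the segment into \<open>L\<close>.\<close>
    define t where "t = 1 / (1 + s)"
    have t: "0 \<le> t" "t \<le> 1" "1 - t = t * s"
      using s(1) by (auto simp: t_def field_simps)
    let ?z = "(1 - t) *\<^sub>R a + t *\<^sub>R b"
    have "?z - p = (1 - t) *\<^sub>R (a - p) + t *\<^sub>R (b - p)"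
      by (simp add: algebra_simps)
    then have "g (?z - p) = (1 - t) *\<^sub>R y a + t *\<^sub>R y b"
      using g by (simp add: y_def linear_add linear_scale)
    also have "\<dots> = 0"
      unfolding t(3) s(2) by simp
    finally have "?z \<in> L"
      using y0 by blast
    moreover have "?z \<in> closed_segment a b"
      using t(1,2) unfolding closed_segment_def by blast
    ultimately show ?thesis
      by blast
  qed
  then show ?thesis
    using XL I_eq M(1,2) by blast
qed simp

end
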